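(* Let $y$ be a feasible solution of the configuration LP, fix a machine $i\in M$ and a Smith prefix $[j^*]$ on machine $i$ whose fractional processing volume $V=\sum_{j\in[j^*]}z_{ij}p_j$ is positive, and let $\mathsf R$ and $F$ be the associated normalized-size random variable and normalized configuration second moment. Then for every $\gamma\ge 0$, \[ F\ \ge\ 2\gamma-\gamma^2+\mathbb E[h_\gamma(\mathsf R)], \] where $h_\gamma(r):=\dfrac{(r-\gamma)_+^2}{r}$ for $r>0$ and $x_+:=\max\{x,0\}$.
   Context: Setting. $J$ is a finite set of $n$ jobs, $M$ a finite set of machines. Each job $j$ has a machine-independent size $p_j>0$, and each feasible pair $(i,j)$ has a weight $w_{ij}>0$ (infeasible pairs are regarded as having $w_{ij}=+\infty$). For $i\in M$ let $J_i=\{j\in J:(i,j)\text{ feasible}\}$ and let $\mathcal F_i$ be the set of all subsets of $J_i$ (configurations). A feasible solution of the configuration LP is a vector $(y_{if})_{i\in M,f\in\mathcal F_i}$ with $y_{if}\ge 0$, $\sum_{f\in\mathcal F_i}y_{if}=1$ for every $i\in M$, and $\sum_{i\in M}\sum_{f\in\mathcal F_i,\,f\ni j}y_{if}=1$ for every $j\in J$. Set $z_{ij}:=\sum_{f\in\mathcal F_i,\,f\ni j}y_{if}$ if $j\in J_i$ and $z_{ij}:=0$ otherwise. For a machine $i$, fix a total order of the jobs refining nonincreasing Smith ratio $w_{ij}/p_j$, and index the jobs $1,\dots,n$ in this order; a Smith prefix is a set $[j^*]=\{1,\dots,j^*\}$ with $1\le j^*\le n$. Fixed-prefix normalization. For fixed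 $i$ and $[j^*]$ let $V:=\sum_{j\in[j^*]}z_{ij}p_j$, assumed $>0$. For $j\in[j^*]$ put $r_j:=p_j/V$ and $\pi_j:=z_{ij}r_j$, so that $\sum_{j\in[j^*]}\pi_j=1$. $\mathsf R$ is the random variable equal to $r_j$ with probability $\pi_j$, i.e. $\mathbb E[g(\mathsf R)]=\sum_{j\in[j^*]}\pi_j\,g(r_j)$ for every function $g$ on $(0,\infty)$. For $f\in\mathcal F_i$ let $T_f:=\sum_{j\in f\cap[j^*]}r_j$, and \[ F:=\sum_{f\in\mathcal F_i}y_{if}T_f^2 . \] *)

theory Defs
  imports "HOL-Probability.Probability"
begin

text \<open>\<open>J\<close> and \<open>M\<close> are the jobs and machines, \<open>E\<close> the set of feasible pairs, \<open>p\<close> the sizes.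
  Values of \<open>w\<close> off \<open>E\<close> are irrelevant: they are replaced by infinity in \<open>ext_weight\<close>.\<close>

definition sched_instance ::
  "'j set \<Rightarrow> 'm set \<Rightarrow> ('m \<times> 'j) set \<Rightarrow> ('j \<Rightarrow> real) \<Rightarrow> ('m \<Rightarrow> 'j \<Rightarrow> real) \<Rightarrow> bool"
  where "sched_instance J M E p w \<longleftrightarrow>
    finite J \<and> finite M \<and> E \<subseteq> M \<times> J \<and> (\<forall>j\<in>J. p j > 0) \<and> (\<forall>(i, j)\<in>E. w i j > 0)"

definition feasible_jobs :: "'j set \<Rightarrow> ('m \<times> 'j) set \<Rightarrow> 'm \<Rightarrow> 'j set"
  where "feasible_jobs J E i = {j \<in> J. (i, j) \<in> E}"

definition configs :: "'j set \<Rightarrow> ('m \<times> 'j) set \<Rightarrow> 'm \<Rightarrow> 'j set set"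
  where "configs J E i = Pow (feasible_jobs J E i)"

definition config_LP_feasible ::
  "'j set \<Rightarrow> 'm set \<Rightarrow> ('m \<times> 'j) set \<Rightarrow> ('m \<Rightarrow> 'j set \<Rightarrow> real) \<Rightarrow> bool"
  where "config_LP_feasible J M E y \<longleftrightarrow>
    (\<forall>i\<in>M. \<forall>f\<in>configs J E i. y i f \<ge> 0) \<and>
    (\<forall>i\<in>M. (\<Sum>f\<in>configs J E i. y i f) = 1) \<and>
    (\<forall>j\<in>J. (\<Sum>i\<in>M. \<Sum>f\<in>{f \<in> configs J E i. j \<in> f}. y i f) = 1)"

definition assign_frac ::
  "'j set \<Rightarrow> ('m \<times> 'j) set \<Rightarrow> ('m \<Rightarrow> 'j set \<Rightarrow> real) \<Rightarrow> 'm \<Rightarrow> 'j \<Rightarrow> real"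
  where "assign_frac J E y i j =
    (if j \<in> feasible_jobs J E i then \<Sum>f\<in>{f \<in> configs J E i. j \<in> f}. y i f else 0)"

definition ext_weight :: "('m \<times> 'j) set \<Rightarrow> ('m \<Rightarrow> 'j \<Rightarrow> real) \<Rightarrow> 'm \<Rightarrow> 'j \<Rightarrow> ereal"
  where "ext_weight E w i j = (if (i, j) \<in> E then ereal (w i j) else \<infinity>)"

definition smith_ratio ::
  "('m \<times> 'j) set \<Rightarrow> ('j \<Rightarrow> real) \<Rightarrow> ('m \<Rightarrow> 'j \<Rightarrow> real) \<Rightarrow> 'm \<Rightarrow> 'j \<Rightarrow> ereal"
  where "smith_ratio E p w i j = ext_weight E w i j / ereal (p j)"

text \<open>A total order of the jobs is given by its enumeration \<open>\<sigma> 1, \<dots>, \<sigma> n\<close>. Infeasible jobs have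
  infinite Smith ratio and hence come first.\<close>

definition smith_order ::
  "'j set \<Rightarrow> ('m \<times> 'j) set \<Rightarrow> ('j \<Rightarrow> real) \<Rightarrow> ('m \<Rightarrow> 'j \<Rightarrow> real) \<Rightarrow> 'm \<Rightarrow> (nat \<Rightarrow> 'j) \<Rightarrow> bool"
  where "smith_order J E p w i \<sigma> \<longleftrightarrow>
    bij_betw \<sigma> {1..card J} J \<and>
    (\<forall>a\<in>{1..card J}. \<forall>b\<in>{1..card J}.
       a \<le> b \<longrightarrow> smith_ratio E p w i (\<sigma> a) \<ge> smith_ratio E p w i (\<sigma> b))"

definition smith_prefix :: "(nat \<Rightarrow> 'j) \<Rightarrow> nat \<Rightarrow> 'j set"
  where "smith_prefix \<sigma> k = \<sigma> ` {1..k}"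

text \<open>In the following, \<open>P\<close> is the prefix and \<open>z\<close> the vector of fractional assignments to a fixed
  machine.\<close>

definition prefix_volume :: "('j \<Rightarrow> real) \<Rightarrow> ('j \<Rightarrow> real) \<Rightarrow> 'j set \<Rightarrow> real"
  where "prefix_volume p z P = (\<Sum>j\<in>P. z j * p j)"

definition norm_size :: "('j \<Rightarrow> real) \<Rightarrow> ('j \<Rightarrow> real) \<Rightarrow> 'j set \<Rightarrow> 'j \<Rightarrow> real"
  where "norm_size p z P j = p j / prefix_volume p z P"

definition size_prob :: "('j \<Rightarrow> real) \<Rightarrow> ('j \<Rightarrow> real) \<Rightarrow> 'j set \<Rightarrow> 'j \<Rightarrow> real"
  where "size_prob p z P j = z j * norm_size p z P j"

text \<open>The law of the normalized-size random variable: draw job \<open>j \<in> P\<close> with probability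
  \<open>size_prob p z P j\<close> and return its normalized size. The weights passed to \<open>embed_pmf\<close> are a
  probability vector whenever \<open>z \<ge> 0\<close>, \<open>p \<ge> 0\<close> on \<open>P\<close> and the volume is positive; see
  \<open>expectation_size_law\<close>.\<close>

definition size_law :: "('j \<Rightarrow> real) \<Rightarrow> ('j \<Rightarrow> real) \<Rightarrow> 'j set \<Rightarrow> real pmf"
  where "size_law p z P =
    map_pmf (norm_size p z P) (embed_pmf (\<lambda>j. if j \<in> P then size_prob p z P j else 0))"

definition config_load :: "('j \<Rightarrow> real) \<Rightarrow> ('j \<Rightarrow> real) \<Rightarrow> 'j set \<Rightarrow> 'j set \<Rightarrow> real"
  where "config_load p z P f = (\<Sum>j\<in>f \<inter> P. norm_size p z P j)"

definition second_moment ::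
  "'j set set \<Rightarrow> ('j set \<Rightarrow> real) \<Rightarrow> ('j \<Rightarrow> real) \<Rightarrow> ('j \<Rightarrow> real) \<Rightarrow> 'j set \<Rightarrow> real"
  where "second_moment \<F> yi p z P = (\<Sum>f\<in>\<F>. yi f * (config_load p z P f)\<^sup>2)"

definition h_fun :: "real \<Rightarrow> real \<Rightarrow> real"
  where "h_fun \<gamma> r = (max (r - \<gamma>) 0)\<^sup>2 / r"

lemma sum_size_prob:
  assumes "prefix_volume p z P > 0"
  shows "(\<Sum>j\<in>P. size_prob p z P j) = 1"
proof -
  have "(\<Sum>j\<in>P. size_prob p z P j) = (\<Sum>j\<in>P. z j * p j) / prefix_volume p z P"
    by (simp add: size_prob_def norm_size_def sum_divide_distrib)
  with assms show ?thesis by (simp add: prefix_volume_def)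
qed

lemma expectation_size_law:
  fixes g :: "real \<Rightarrow> real"
  assumes fin: "finite P" and nonneg: "\<And>j. j \<in> P \<Longrightarrow> z j \<ge> 0" "\<And>j. j \<in> P \<Longrightarrow> p j \<ge> 0"
    and pos: "prefix_volume p z P > 0"
  shows "measure_pmf.expectation (size_law p z P) g =
    (\<Sum>j\<in>P. size_prob p z P j * g (norm_size p z P j))"
proof -
  let ?q = "\<lambda>j. if j \<in> P then size_prob p z P j else 0"
  have q0: "?q j \<ge> 0" for j
    using nonneg pos by (auto simp: size_prob_def norm_size_def)
  have "(\<integral>\<^sup>+ j. ennreal (?q j) \<partial>count_space UNIV) = (\<Sum>j\<in>P. ennreal (?q j))"
    using fin by (intro nn_integral_count_space') auto
  also have "\<dots> = ennreal (\<Sum>j\<in>P. ?q j)"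
    by (intro sum_ennreal q0)
  also have "\<dots> = 1"
    using sum_size_prob[OF pos] by simp
  finally have pmf_q: "pmf (embed_pmf ?q) j = ?q j" for j
    using q0 by (intro pmf_embed_pmf) auto
  have "measure_pmf.expectation (size_law p z P) g =
      measure_pmf.expectation (embed_pmf ?q) (\<lambda>j. g (norm_size p z P j))"
    by (simp add: size_law_def)
  also have "\<dots> = (\<Sum>j\<in>P. g (norm_size p z P j) * pmf (embed_pmf ?q) j)"
    using fin by (intro integral_measure_pmf_real) (auto simp: set_pmf_iff pmf_q split: if_splits)
  also have "\<dots> = (\<Sum>j\<in>P. size_prob p z P j * g (norm_size p z P j))"
    by (intro sum.cong) (auto simp: pmf_q)
  finally show ?thesis .
qed

end

theory Submission
  imports Defs
begin

text \<open>Averaging over the configurations, with weights \<open>y i f\<close>, turns \<open>\<Sum>\<^sub>j z\<^sub>j g\<^sub>j\<close> into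
  the mean of the configuration sums of \<open>g\<close>. Hence the normalized loads \<open>T\<^sub>f\<close> have mean \<open>1\<close>, and
  \<open>E[h\<^sub>\<gamma>(R)] = \<Sum>\<^sub>j z\<^sub>j (r\<^sub>j - \<gamma>)\<^sub>+\<^sup>2\<close> is the mean of \<open>\<Sum>\<^sub>j\<^sub>\<in>\<^sub>f (r\<^sub>j - \<gamma>)\<^sub>+\<^sup>2\<close>. The bound is
  therefore the mean of the pointwise inequality \<open>(T\<^sub>f - \<gamma>)\<^sup>2 \<ge> \<Sum>\<^sub>j\<^sub>\<in>\<^sub>f (r\<^sub>j - \<gamma>)\<^sub>+\<^sup>2\<close>, which holds
  because \<open>x \<mapsto> (x - \<gamma>)\<^sub>+\<^sup>2\<close> is superadditive on the nonnegative reals.\<close>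

text \<open>For nonnegative reals, squaring a sum only adds a cross term, so it suffices that the
  positive parts themselves are superadditive. If both are active, \<open>\<gamma>\<close> is
  subtracted twice on the left and once on the right; if only one is, the other summand is still
  nonnegative.\<close>

lemma positive_part_square_superadd:
  fixes a b \<gamma> :: real
  assumes "a \<ge> 0" "b \<ge> 0" "\<gamma> \<ge> 0"
  shows "(max (a - \<gamma>) 0)\<^sup>2 + (max (b - \<gamma>) 0)\<^sup>2 \<le> (max (a + b - \<gamma>) 0)\<^sup>2"
proof -
  let ?u = "max (a - \<gamma>) 0" and ?v = "max (b - \<gamma>) 0"
  have "?u\<^sup>2 + ?v\<^sup>2 \<le> (?u + ?v)\<^sup>2"
    by (simp add: power2_sum)
  also have "\<dots> \<le> (max (a + b - \<gamma>) 0)\<^sup>2"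
    using assms by (intro power_mono) (auto simp: max_def)
  finally show ?thesis .
qed

lemma sum_positive_part_square_le:
  fixes r :: "'a \<Rightarrow> real"
  assumes "finite A" and "\<And>j. j \<in> A \<Longrightarrow> r j \<ge> 0" and "\<gamma> \<ge> 0"
  shows "(\<Sum>j\<in>A. (max (r j - \<gamma>) 0)\<^sup>2) \<le> (max (sum r A - \<gamma>) 0)\<^sup>2"
  using assms(1,2)
proof (induction A rule: finite_induct)
  case (insert j A)
  then have "(max (r j - \<gamma>) 0)\<^sup>2 + (max (sum r A - \<gamma>) 0)\<^sup>2 \<le> (max (r j + sum r A - \<gamma>) 0)\<^sup>2"
    using assms(3) by (intro positive_part_square_superadd sum_nonneg) auto
  with insert show ?case by simp
qed simp

lemma assign_frac_nonneg:
  assumes "\<And>f. f \<in> configs J E i \<Longrightarrow> y i f \<ge> 0"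
  shows "assign_frac J E y i j \<ge> 0"
  using assms by (auto simp: assign_frac_def intro: sum_nonneg)

text \<open>An infeasible job lies in no configuration, so both branches of
  \<open>assign_frac\<close> become one sum. Its index set does not depend on \<open>j\<close>,
  which allows exchanging summations.\<close>

lemma assign_frac_eq:
  assumes "finite J"
  shows "assign_frac J E y i j = (\<Sum>f\<in>configs J E i. if j \<in> f then y i f else 0)"
proof -
  have "finite (configs J E i)"
    using assms by (simp add: configs_def feasible_jobs_def)
  then have "(\<Sum>f\<in>{f \<in> configs J E i. j \<in> f}. y i f)
      = (\<Sum>f\<in>configs J E i. if j \<in> f then y i f else 0)"
    by (rule sum.inter_filter)
  moreover have "{f \<in> configs J E i. j \<in> f} = {}" if "j \<notin> feasible_jobs J E i"
    using that by (auto simp: configs_def)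
  ultimately show ?thesis
    by (metis assign_frac_def sum.empty)
qed

lemma sum_assign_frac_mult:
  assumes "finite J" "finite P"
  shows "(\<Sum>j\<in>P. assign_frac J E y i j * g j) = (\<Sum>f\<in>configs J E i. y i f * (\<Sum>j\<in>f \<inter> P. g j))"
proof -
  have "(\<Sum>j\<in>P. assign_frac J E y i j * g j)
      = (\<Sum>j\<in>P. \<Sum>f\<in>configs J E i. (if j \<in> f then y i f else 0) * g j)"
    using assms(1) by (simp add: assign_frac_eq sum_distrib_right)
  also have "\<dots> = (\<Sum>f\<in>configs J E i. \<Sum>j\<in>P. (if j \<in> f then y i f else 0) * g j)"
    by (rule sum.swap)
  also have "\<dots> = (\<Sum>f\<in>configs J E i. y i f * (\<Sum>j\<in>f \<inter> P. g j))"
  proof (rule sum.cong[OF refl])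
    fix f
    have "(\<Sum>j\<in>P. (if j \<in> f then y i f else 0) * g j) = (\<Sum>j\<in>P. if j \<in> f then y i f * g j else 0)"
      by (intro sum.cong) auto
    also have "\<dots> = (\<Sum>j\<in>P \<inter> f. y i f * g j)"
      using assms(2) by (rule sum.inter_restrict[symmetric])
    finally show "(\<Sum>j\<in>P. (if j \<in> f then y i f else 0) * g j) = y i f * (\<Sum>j\<in>f \<inter> P. g j)"
      by (simp add: sum_distrib_left Int_commute)
  qed
  finally show ?thesis .
qed

theorem theorem3p1:
  fixes J :: "'j set" and M :: "'m set" and E :: "('m \<times> 'j) set"
    and p :: "'j \<Rightarrow> real" and w :: "'m \<Rightarrow> 'j \<Rightarrow> real"
    and y :: "'m \<Rightarrow> 'j set \<Rightarrow> real"
    and i :: 'm and \<sigma> :: "nat \<Rightarrow> 'j" and jstar :: nat and \<gamma> :: real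
  defines "z \<equiv> assign_frac J E y i"
    and "P \<equiv> smith_prefix \<sigma> jstar"
  assumes "sched_instance J M E p w"
    and "config_LP_feasible J M E y"
    and "i \<in> M"
    and "smith_order J E p w i \<sigma>"
    and "1 \<le> jstar" and "jstar \<le> card J"
    and "prefix_volume p z P > 0"
    and "\<gamma> \<ge> 0"
  shows "second_moment (configs J E i) (y i) p z P
    \<ge> 2 * \<gamma> - \<gamma>\<^sup>2 + measure_pmf.expectation (size_law p z P) (h_fun \<gamma>)"
proof -
  let ?C = "configs J E i" and ?r = "norm_size p z P" and ?T = "config_load p z P"
  have finJ: "finite J" and ppos: "\<And>j. j \<in> J \<Longrightarrow> p j > 0"
    using assms(3) by (auto simp: sched_instance_def)
  have y0: "\<And>f. f \<in> ?C \<Longrightarrow> y i f \<ge> 0" and y1: "(\<Sum>f\<in>?C. y i f) = 1"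
    using assms(4,5) by (auto simp: config_LP_feasible_def)
  have finP: "finite P"
    by (simp add: P_def smith_prefix_def)
  \<comment> \<open>Since \<open>jstar \<le> card J\<close>, the indices stay in the range where
    \<open>\<sigma>\<close> enumerates \<open>J\<close>.\<close>
  have "P \<subseteq> J"
    using assms(6,8) by (fastforce simp: P_def smith_prefix_def smith_order_def bij_betw_def)
  then have rpos: "?r j > 0" and p0: "p j \<ge> 0" if "j \<in> P" for j
    using that ppos[of j] assms(9) by (auto simp: norm_size_def)
  have z0: "z j \<ge> 0" for j
    using y0 by (simp add: z_def assign_frac_nonneg)
  have swap: "(\<Sum>j\<in>P. z j * g j) = (\<Sum>f\<in>?C. y i f * (\<Sum>j\<in>f \<inter> P. g j))" for g
    unfolding z_def by (rule sum_assign_frac_mult[OF finJ finP])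
  have mean_load: "(\<Sum>f\<in>?C. y i f * ?T f) = 1"
    using sum_size_prob[OF assms(9)] swap[of ?r] by (simp add: size_prob_def config_load_def)
  have "measure_pmf.expectation (size_law p z P) (h_fun \<gamma>)
      = (\<Sum>j\<in>P. size_prob p z P j * h_fun \<gamma> (?r j))"
    by (rule expectation_size_law[OF finP z0 p0 assms(9)])
  \<comment> \<open>The factor \<open>?r j\<close> in \<open>size_prob\<close> cancels the
    denominator of \<open>h_fun\<close>, as \<open>?r j\<close> is nonzero on
    \<open>P\<close>.\<close>
  also have "\<dots> = (\<Sum>j\<in>P. z j * (max (?r j - \<gamma>) 0)\<^sup>2)"
  proof (rule sum.cong[OF refl])
    fix j assume "j \<in> P"
    then have "?r j \<noteq> 0" using rpos by force
    then show "size_prob p z P j * h_fun \<gamma> (?r j) = z j * (max (?r j - \<gamma>) 0)\<^sup>2"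
      by (simp add: size_prob_def h_fun_def)
  qed
  also have "\<dots> = (\<Sum>f\<in>?C. y i f * (\<Sum>j\<in>f \<inter> P. (max (?r j - \<gamma>) 0)\<^sup>2))"
    by (rule swap)
  also have "\<dots> \<le> (\<Sum>f\<in>?C. y i f * (?T f - \<gamma>)\<^sup>2)"
  proof (intro sum_mono mult_left_mono y0)
    fix f
    have "(\<Sum>j\<in>f \<inter> P. (max (?r j - \<gamma>) 0)\<^sup>2) \<le> (max (?T f - \<gamma>) 0)\<^sup>2"
      unfolding config_load_def using finP rpos assms(10)
      by (intro sum_positive_part_square_le) (auto intro: less_imp_le)
    \<comment> \<open>Below \<open>\<gamma>\<close> the positive part vanishes; otherwise both sides
      agree.\<close>
    also have "\<dots> \<le> (?T f - \<gamma>)\<^sup>2"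
      by (simp add: max_def)
    finally show "(\<Sum>j\<in>f \<inter> P. (max (?r j - \<gamma>) 0)\<^sup>2) \<le> (?T f - \<gamma>)\<^sup>2" .
  qed
  also have "\<dots> = (\<Sum>f\<in>?C. y i f * (?T f)\<^sup>2 - 2 * \<gamma> * (y i f * ?T f) + \<gamma>\<^sup>2 * y i f)"
    by (intro sum.cong) (auto simp: power2_eq_square algebra_simps)
  \<comment> \<open>Mean load 1 fixes the linear term, total weight 1 the constant.\<close>
  also have "\<dots> = second_moment ?C (y i) p z P - 2 * \<gamma> + \<gamma>\<^sup>2"
    using mean_load y1
    by (simp add: second_moment_def sum.distrib sum_subtractf sum_distrib_left[symmetric])
  finally show ?thesis by simp
qed

end
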